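(* Let $C$ be a nonempty closed convex subset of a Banach space $X$ and let $T:C\to C$ be a contraction mapping. Let $\{x_n\}_{n=0}^{\infty}$ be the sequence generated from $x_0\in C$ by the $K$ iteration process $$z_n=(1-\beta_n)x_n+\beta_nTx_n,\qquad y_n=T\big((1-\alpha_n)Tx_n+\alpha_nTz_n\big),\qquad x_{n+1}=Ty_n\qquad(n\ge 0),$$ with real sequences $\{\alpha_n\}_{n=0}^{\infty}$ and $\{\beta_n\}_{n=0}^{\infty}$ in $[0,1]$ satisfying $\sum_{n=0}^{\infty}\alpha_n\beta_n=\infty$. Then this iteration process is $T$-stable.
   Context: A mapping $T:C\to C$ is a contraction if there exists $\theta\in(0,1)$ such that $\|Tx-Ty\|\le\theta\|x-y\|$ for all $x,y\in C$. Stability: let $x_{n+1}=f(T,x_n)$ be an iteration procedure converging to a fixed point $p$ of $T$. It is said to be $T$-stable (stable with respect to $T$) if for every sequence $\{t_n\}_{n=0}^{\infty}$ in $C$, with $\epsilon_n=\|t_{n+1}-f(T,t_n)\|$ for $n=0,1,2,\dots$, one has $$\lim_{n\to\infty}\epsilon_n=0\iff\lim_{n\to\infty}t_n=p.$$ For the $K$ iteration process, the step map at stage $n$ (which depends on $n$ through $\alpha_n,\beta_n$) is $$f(T,t_n)=T\Big(T\big((1-\alpha_n)Tt_n+\alpha_nT((1-\beta_n)t_n+\beta_nTt_n)\big)\Big).$$ *)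

theory Defs
  imports "HOL-Analysis.Analysis"
begin

definition contraction_on :: "'a::real_normed_vector set \<Rightarrow> ('a \<Rightarrow> 'a) \<Rightarrow> bool" where
  "contraction_on C T \<longleftrightarrow> T \<in> C \<rightarrow> C \<and>
     (\<exists>\<theta>. 0 < \<theta> \<and> \<theta> < 1 \<and> (\<forall>x\<in>C. \<forall>y\<in>C. norm (T x - T y) \<le> \<theta> * norm (x - y)))"

text \<open>
  An iteration procedure is given by step maps \<open>f n\<close>, one for each stage \<open>n\<close>, that take the
  operator \<open>T\<close> and the current iterate. The notion of stability is introduced only for a
  procedure that converges to a fixed point of \<open>T\<close>; this is made part of the predicate, so
  stability of \<open>x\<close> includes that \<open>x\<close> is generated by \<open>f\<close> and converges to a fixed point.
\<close>

definition stable_iteration ::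
  "'a::real_normed_vector set \<Rightarrow> ('a \<Rightarrow> 'a) \<Rightarrow> (nat \<Rightarrow> ('a \<Rightarrow> 'a) \<Rightarrow> 'a \<Rightarrow> 'a) \<Rightarrow> (nat \<Rightarrow> 'a) \<Rightarrow> bool"
where
  "stable_iteration C T f x \<longleftrightarrow>
     (\<forall>n. x n \<in> C) \<and> (\<forall>n. x (Suc n) = f n T (x n)) \<and>
     (\<exists>p\<in>C. T p = p \<and> x \<longlonglongrightarrow> p \<and>
        (\<forall>t. (\<forall>n. t n \<in> C) \<longrightarrow>
           ((\<lambda>n. norm (t (Suc n) - f n T (t n))) \<longlonglongrightarrow> 0 \<longleftrightarrow> t \<longlonglongrightarrow> p)))"

definition K_step ::
  "(nat \<Rightarrow> real) \<Rightarrow> (nat \<Rightarrow> real) \<Rightarrow> nat \<Rightarrow> ('a \<Rightarrow> 'a) \<Rightarrow> 'a \<Rightarrow> 'a::real_vector"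
where
  "K_step \<alpha> \<beta> n T u =
     T (T ((1 - \<alpha> n) *\<^sub>R T u + \<alpha> n *\<^sub>R T ((1 - \<beta> n) *\<^sub>R u + \<beta> n *\<^sub>R T u)))"

end

theory Submission
  imports Defs
begin

text \<open>
  For weights in \<open>[0, 1]\<close>, each step map of the \<open>K\<close> iteration brings every point of
  \<open>C\<close> closer to the fixed point \<open>p\<close> of \<open>T\<close> by the factor \<open>\<theta>\<close> of the contraction: convex
  combinations do not increase the distance to \<open>p\<close>, and the outermost \<open>T\<close> already contributes
  \<open>\<theta>\<close>. This factor is the same at all stages (lemma \<open>K_step_quasi_contraction\<close>).

  A uniform factor gives stability for an arbitrary procedure. With
  \<open>\<epsilon>\<^sub>n = \<parallel>t\<^sub>n\<^sub>+\<^sub>1 - f\<^sub>n(t\<^sub>n)\<parallel>\<close>, the triangle inequality yields both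
  \<open>\<parallel>t\<^sub>n\<^sub>+\<^sub>1 - p\<parallel> \<le> \<theta>\<parallel>t\<^sub>n - p\<parallel> + \<epsilon>\<^sub>n\<close> and
  \<open>\<epsilon>\<^sub>n \<le> \<parallel>t\<^sub>n\<^sub>+\<^sub>1 - p\<parallel> + \<theta>\<parallel>t\<^sub>n - p\<parallel>\<close>. The second bound shows that convergence to \<open>p\<close>
  forces \<open>\<epsilon>\<^sub>n \<longlonglongrightarrow> 0\<close>; the first gives the converse, because a geometric recursion forgets
  its past and keeps only vanishing perturbations (lemma \<open>perturbed_geometric_tendsto_0\<close>).
  The iteration itself is the case in which all \<open>\<epsilon>\<^sub>n\<close> are \<open>0\<close>, so it converges to \<open>p\<close>, whose
  existence is the Banach fixed point theorem.
\<close>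

text \<open>
  Once the perturbation is below \<open>(1 - \<theta>) \<epsilon> / 2\<close>, the value \<open>\<epsilon> / 2\<close> is a fixed point of the
  majorising recursion, and the excess over it decays geometrically.
\<close>
lemma perturbed_geometric_tendsto_0:
  fixes a e :: "nat \<Rightarrow> real"
  assumes \<theta>: "0 \<le> \<theta>" "\<theta> < 1"
    and nonneg: "\<And>n. 0 \<le> a n"
    and rec: "\<And>n. a (Suc n) \<le> \<theta> * a n + e n"
    and e: "e \<longlonglongrightarrow> 0"
  shows "a \<longlonglongrightarrow> 0"
proof (rule LIMSEQ_I)
  fix \<epsilon> :: real
  assume "0 < \<epsilon>"
  then have "0 < (1 - \<theta>) * (\<epsilon> / 2)"
    using \<theta> by simp
  from LIMSEQ_D[OF e this] obtain N where N: "\<And>n. n \<ge> N \<Longrightarrow> e n \<le> (1 - \<theta>) * (\<epsilon> / 2)"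
    by force
  have majorant: "a (k + N) \<le> \<theta> ^ k * a N + \<epsilon> / 2" for k
  proof (induction k)
    case 0
    then show ?case using \<open>0 < \<epsilon>\<close> by simp
  next
    case (Suc k)
    have "a (Suc k + N) \<le> \<theta> * a (k + N) + e (k + N)"
      using rec[of "k + N"] by simp
    also have "\<dots> \<le> \<theta> * (\<theta> ^ k * a N + \<epsilon> / 2) + (1 - \<theta>) * (\<epsilon> / 2)"
      by (intro add_mono mult_left_mono Suc.IH N \<theta>) simp
    also have "\<dots> = \<theta> ^ Suc k * a N + \<epsilon> / 2"
      by (simp add: field_simps)
    finally show ?case .
  qed
  have "(\<lambda>k. \<theta> ^ k * a N) \<longlonglongrightarrow> 0"
    using \<theta> by (intro tendsto_mult_left_zero LIMSEQ_realpow_zero)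
  from LIMSEQ_D[OF this, of "\<epsilon> / 2"] \<open>0 < \<epsilon>\<close>
  obtain K where K: "\<And>k. k \<ge> K \<Longrightarrow> \<bar>\<theta> ^ k * a N\<bar> < \<epsilon> / 2"
    by auto
  have "norm (a n - 0) < \<epsilon>" if "n \<ge> K + N" for n
  proof -
    have "\<theta> ^ (n - N) * a N < \<epsilon> / 2"
      using K[of "n - N"] that by linarith
    then show ?thesis
      using majorant[of "n - N"] nonneg[of n] that by simp
  qed
  then show "\<exists>no. \<forall>n\<ge>no. norm (a n - 0) < \<epsilon>"
    by blast
qed

lemma residual_tendsto_0_iff_tendsto:
  fixes p :: "'a::real_normed_vector" and t :: "nat \<Rightarrow> 'a"
  assumes \<theta>: "0 \<le> \<theta>" "\<theta> < 1"
    and contr: "\<And>n. norm (g n (t n) - p) \<le> \<theta> * norm (t n - p)"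
  shows "(\<lambda>n. norm (t (Suc n) - g n (t n))) \<longlonglongrightarrow> 0 \<longleftrightarrow> t \<longlonglongrightarrow> p"
proof
  assume residual: "(\<lambda>n. norm (t (Suc n) - g n (t n))) \<longlonglongrightarrow> 0"
  have "norm (t (Suc n) - p) \<le> \<theta> * norm (t n - p) + norm (t (Suc n) - g n (t n))" for n
    using norm_triangle_ineq[of "t (Suc n) - g n (t n)" "g n (t n) - p"] contr[of n] by simp
  then have "(\<lambda>n. norm (t n - p)) \<longlonglongrightarrow> 0"
    using perturbed_geometric_tendsto_0[OF \<theta> _ _ residual] by simp
  then show "t \<longlonglongrightarrow> p"
    by (simp add: tendsto_norm_zero_iff LIM_zero_iff)
next
  assume "t \<longlonglongrightarrow> p"
  then have dist_p: "(\<lambda>n. norm (t n - p)) \<longlonglongrightarrow> 0"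
    by (simp add: tendsto_norm_zero_iff LIM_zero_iff)
  have bound: "(\<lambda>n. norm (t (Suc n) - p) + \<theta> * norm (t n - p)) \<longlonglongrightarrow> 0"
    using tendsto_add[OF LIMSEQ_Suc[OF dist_p] tendsto_mult_right_zero[OF dist_p, of \<theta>]] by simp
  have "norm (t (Suc n) - g n (t n)) \<le> norm (t (Suc n) - p) + \<theta> * norm (t n - p)" for n
    using norm_triangle_ineq4[of "t (Suc n) - p" "g n (t n) - p"] contr[of n] by simp
  then show "(\<lambda>n. norm (t (Suc n) - g n (t n))) \<longlonglongrightarrow> 0"
    by (intro Lim_null_comparison[OF _ bound] always_eventually) simp
qed

text \<open>
  The iterates form a sequence with zero residuals, so the equivalence that is stability also
  yields their convergence to \<open>p\<close>.
\<close>
lemma stable_iteration_if_quasi_contraction: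
  assumes p: "p \<in> C" "T p = p" and \<theta>: "0 \<le> \<theta>" "\<theta> < 1"
    and maps: "\<And>n u. u \<in> C \<Longrightarrow> f n T u \<in> C"
    and contr: "\<And>n u. u \<in> C \<Longrightarrow> norm (f n T u - p) \<le> \<theta> * norm (u - p)"
    and x0: "x 0 \<in> C" and step: "\<And>n. x (Suc n) = f n T (x n)"
  shows "stable_iteration C T f x"
proof -
  have stable: "(\<lambda>n. norm (t (Suc n) - f n T (t n))) \<longlonglongrightarrow> 0 \<longleftrightarrow> t \<longlonglongrightarrow> p"
    if "\<forall>n. t n \<in> C" for t
    using that by (intro residual_tendsto_0_iff_tendsto[OF \<theta>] contr) blast
  have x_in: "x n \<in> C" for n
    by (induction n) (simp_all add: x0 step maps)
  have "x \<longlonglongrightarrow> p"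
    using stable[of x] x_in by (simp add: step)
  then show ?thesis
    unfolding stable_iteration_def using p x_in step stable by blast
qed

lemma norm_convex_combination_diff_le:
  fixes u v p :: "'a::real_normed_vector"
  assumes "a \<in> {0..1}" "norm (u - p) \<le> r" "norm (v - p) \<le> r"
  shows "norm ((1 - a) *\<^sub>R u + a *\<^sub>R v - p) \<le> r"
  using convexD_alt[OF convex_cball[of p r], of u v a] assms
  by (simp add: dist_norm norm_minus_commute)

lemma convex_combination_mem:
  assumes "convex C" "u \<in> C" "v \<in> C" "a \<in> {0..1}"
  shows "(1 - a) *\<^sub>R u + a *\<^sub>R v \<in> C"
  using convexD_alt[of C u v a] assms by simp

lemma K_step_mem:
  assumes "convex C" "T \<in> C \<rightarrow> C" "\<alpha> n \<in> {0..1}" "\<beta> n \<in> {0..1}" "u \<in> C"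
  shows "K_step \<alpha> \<beta> n T u \<in> C"
proof -
  have T: "T v \<in> C" if "v \<in> C" for v
    using assms(2) that by (rule funcset_mem)
  show ?thesis
    unfolding K_step_def by (intro T convex_combination_mem assms)
qed

text \<open>
  Every argument of \<open>T\<close> inside the step stays in the ball of radius \<open>\<parallel>u - p\<parallel>\<close> around \<open>p\<close>. The
  outermost application of \<open>T\<close> supplies the factor \<open>\<theta>\<close>.
\<close>
lemma K_step_quasi_contraction:
  fixes p :: "'a::real_normed_vector"
  assumes C: "convex C" and T: "T \<in> C \<rightarrow> C"
    and \<theta>: "0 \<le> \<theta>" "\<theta> < 1"
    and contr: "\<And>v. v \<in> C \<Longrightarrow> norm (T v - p) \<le> \<theta> * norm (v - p)"
    and \<alpha>: "\<alpha> n \<in> {0..1}" and \<beta>: "\<beta> n \<in> {0..1}" and u: "u \<in> C"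
  shows "norm (K_step \<alpha> \<beta> n T u - p) \<le> \<theta> * norm (u - p)"
proof -
  let ?r = "norm (u - p)"
  define z where "z = (1 - \<beta> n) *\<^sub>R u + \<beta> n *\<^sub>R T u"
  define w where "w = (1 - \<alpha> n) *\<^sub>R T u + \<alpha> n *\<^sub>R T z"
  have Tin: "T v \<in> C" if "v \<in> C" for v
    using T that by (rule funcset_mem)
  have nonexp: "norm (T v - p) \<le> ?r" if "v \<in> C" "norm (v - p) \<le> ?r" for v
  proof -
    have "norm (T v - p) \<le> \<theta> * norm (v - p)"
      by (rule contr) fact
    also have "\<dots> \<le> norm (v - p)"
      using \<theta> by (intro mult_left_le_one_le) auto
    finally show ?thesis using that by simp
  qed
  have z: "z \<in> C" "norm (z - p) \<le> ?r"
    unfolding z_def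
    by (intro convex_combination_mem norm_convex_combination_diff_le Tin nonexp C u \<beta> order_refl)+
  have w: "w \<in> C" "norm (w - p) \<le> ?r"
    unfolding w_def
    by (intro convex_combination_mem norm_convex_combination_diff_le Tin nonexp C u \<alpha> z order_refl)+
  have "norm (T (T w) - p) \<le> \<theta> * norm (T w - p)"
    by (intro contr Tin w)
  also have "\<dots> \<le> \<theta> * ?r"
    by (intro mult_left_mono nonexp w \<theta>)
  finally show ?thesis
    by (simp add: K_step_def w_def z_def)
qed

theorem theorem3p3:
  fixes C :: "'a::banach set" and T :: "'a \<Rightarrow> 'a"
    and x y z :: "nat \<Rightarrow> 'a" and \<alpha> \<beta> :: "nat \<Rightarrow> real"
  assumes "C \<noteq> {}" and "closed C" and "convex C"
    and "contraction_on C T"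
    and "\<And>n. \<alpha> n \<in> {0..1}" and "\<And>n. \<beta> n \<in> {0..1}"
    and "filterlim (\<lambda>n. \<Sum>k\<le>n. \<alpha> k * \<beta> k) at_top sequentially"
    and "x 0 \<in> C"
    and "\<And>n. z n = (1 - \<beta> n) *\<^sub>R x n + \<beta> n *\<^sub>R T (x n)"
    and "\<And>n. y n = T ((1 - \<alpha> n) *\<^sub>R T (x n) + \<alpha> n *\<^sub>R T (z n))"
    and "\<And>n. x (Suc n) = T (y n)"
  shows "stable_iteration C T (K_step \<alpha> \<beta>) x"
proof -
  obtain \<theta> where \<theta>: "0 < \<theta>" "\<theta> < 1" and T: "T \<in> C \<rightarrow> C"
    and contr: "\<And>u v. u \<in> C \<Longrightarrow> v \<in> C \<Longrightarrow> norm (T u - T v) \<le> \<theta> * norm (u - v)"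
    using assms(4) unfolding contraction_on_def by blast
  have "\<exists>!p\<in>C. T p = p"
  proof (rule Banach_fix)
    show "complete C"
      using assms(2) by (simp add: complete_eq_closed)
    show "T ` C \<subseteq> C"
      using funcset_mem[OF T] by blast
    show "dist (T u) (T v) \<le> \<theta> * dist u v" if "u \<in> C" "v \<in> C" for u v
      using contr[OF that] by (simp add: dist_norm)
  qed (use \<theta> assms(1) in auto)
  then obtain p where p: "p \<in> C" "T p = p"
    by blast
  show ?thesis
  proof (rule stable_iteration_if_quasi_contraction[where p = p and \<theta> = \<theta>])
    show "K_step \<alpha> \<beta> n T u \<in> C" if "u \<in> C" for n u
      using assms(3) T assms(5,6) that by (rule K_step_mem)
    show "norm (K_step \<alpha> \<beta> n T u - p) \<le> \<theta> * norm (u - p)" if "u \<in> C" for n u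
    proof (rule K_step_quasi_contraction[OF assms(3) T])
      show "norm (T v - p) \<le> \<theta> * norm (v - p)" if "v \<in> C" for v
        using contr[OF that p(1)] p(2) by simp
    qed (use \<theta> assms(5,6) that in simp_all)
    show "x (Suc n) = K_step \<alpha> \<beta> n T (x n)" for n
      by (simp add: K_step_def assms(9-11))
  qed (use p \<theta> assms(8) in auto)
qed

end
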